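(* Let $(X,T)$ be a topological flow. If $(X,T)$ is distal and has a minimal sensitive subsystem (i.e. there is a minimal subset $M\subseteq X$ such that $(M,T)$ is sensitive), then $(E(X),T)$ is sensitive.
   Context: A (topological) flow $(X,T)$ consists of a compact Hausdorff space $X$, a topological group $T$, and a continuous map $\pi:T\times X\to X$, written $\pi(t,x)=tx$, with $(st)x=s(tx)$ and such that each $\pi^t:X\to X$, $\pi^t(x)=tx$, is a homeomorphism (so the identity of $T$ acts as the identity map). Standing assumption: the space $X$ of the given flow has no isolated points (this is not required of $E(X)$ or of subsystems). The enveloping semigroup is $E(X)=\overline{\{\pi^t: t\in T\}}\subseteq X^X$, the closure being taken in the product topology; $T$ acts on the compact Hausdorff space $E(X)$ by $t\cdot p=\pi^t\circ p$, giving the induced flow $(E(X),T)$. A subset $A\subseteq X$ is invariant if $TA\subseteq A$; a subset $M\subseteq X$ is minimal if it is non-empty, closed and invariant and has no proper subset with these properties; $T$ acts on $M$ by restriction. The notions below apply to any compact Hausdorff space $Y$ with a continuous action of $T$, where $\mathcal{U}_Y$ denotes the unique uniformity compatible with the topology of $Y$, and $U[x]=\{y:(x,y)\in U\}$. A pair $(x,y)\in Y\times Y$ is proximal if for every $U\in\mathcal{U}_Y$ there is $t\in T$ with $(tx,ty)\in U$; $(Y,T)$ is distal if no pair $(x,y)$ with $x\ne y$ is proximal. $(Y,T)$ is sensitive if there is $V\in\mathcal{U}_Y$ such that for every $x\in Y$ and $U\in\mathcal{U}_Y$ there are $y\in U[x]$ and $t\in T$ with $(tx,ty)\notin V$. 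*)

theory Defs
  imports "HOL-Analysis.Analysis" "HOL-Algebra.Group"
begin

section \<open>Uniformities\<close>

definition uniformity_on :: "'a set \<Rightarrow> ('a \<times> 'a) set set \<Rightarrow> bool" where
  "uniformity_on A \<U> \<longleftrightarrow>
     A \<times> A \<in> \<U> \<and>
     (\<forall>U\<in>\<U>. Id_on A \<subseteq> U \<and> U \<subseteq> A \<times> A) \<and>
     (\<forall>U\<in>\<U>. \<forall>V. U \<subseteq> V \<and> V \<subseteq> A \<times> A \<longrightarrow> V \<in> \<U>) \<and>
     (\<forall>U\<in>\<U>. \<forall>V\<in>\<U>. U \<inter> V \<in> \<U>) \<and>
     (\<forall>U\<in>\<U>. U\<inverse> \<in> \<U>) \<and>
     (\<forall>U\<in>\<U>. \<exists>V\<in>\<U>. V O V \<subseteq> U)"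

text \<open>For an entourage \<open>U\<close>, the set \<open>U[x] = {y. (x, y) \<in> U}\<close> is \<open>U `` {x}\<close>.\<close>

definition compatible_uniformity :: "'a topology \<Rightarrow> ('a \<times> 'a) set set \<Rightarrow> bool" where
  "compatible_uniformity Y \<U> \<longleftrightarrow>
     uniformity_on (topspace Y) \<U> \<and>
     (\<forall>W. openin Y W \<longleftrightarrow> W \<subseteq> topspace Y \<and> (\<forall>x\<in>W. \<exists>U\<in>\<U>. U `` {x} \<subseteq> W))"

text \<open>Only meaningful for compact Hausdorff \<open>Y\<close>; for those, existence and uniqueness are
  lemma \<open>compatible_uniformity_ex1\<close> below.\<close>

definition the_uniformity :: "'a topology \<Rightarrow> ('a \<times> 'a) set set" where
  "the_uniformity Y = (THE \<U>. compatible_uniformity Y \<U>)"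

lemma compatible_uniformity_subset:
  assumes "compatible_uniformity Y \<U>" "U \<in> \<U>"
  shows "U \<subseteq> topspace Y \<times> topspace Y" "Id_on (topspace Y) \<subseteq> U"
  using assms unfolding compatible_uniformity_def uniformity_on_def by auto

lemma compatible_uniformity_half:
  assumes "compatible_uniformity Y \<U>" "U \<in> \<U>"
  obtains V where "V \<in> \<U>" "V\<inverse> = V" "V O V \<subseteq> U"
proof -
  obtain V where V: "V \<in> \<U>" "V O V \<subseteq> U"
    using assms unfolding compatible_uniformity_def uniformity_on_def by meson
  have "V \<inter> V\<inverse> \<in> \<U>"
    using V assms unfolding compatible_uniformity_def uniformity_on_def by meson
  moreover have "(V \<inter> V\<inverse>)\<inverse> = V \<inter> V\<inverse>"
    by auto
  moreover have "(V \<inter> V\<inverse>) O (V \<inter> V\<inverse>) \<subseteq> U"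
    using V by auto
  ultimately show ?thesis
    using that by blast
qed

lemma compatible_uniformity_nhd:
  assumes U: "compatible_uniformity Y \<U>" "U \<in> \<U>" and x: "x \<in> topspace Y"
  obtains W where "openin Y W" "x \<in> W" "W \<subseteq> U `` {x}"
proof
  let ?W = "{y \<in> topspace Y. \<exists>V\<in>\<U>. V `` {y} \<subseteq> U `` {x}}"
  have "\<exists>V\<in>\<U>. V `` {y} \<subseteq> ?W" if y: "y \<in> ?W" for y
  proof -
    obtain V where V: "V \<in> \<U>" "V `` {y} \<subseteq> U `` {x}"
      using y by blast
    obtain V' where V': "V' \<in> \<U>" "V'\<inverse> = V'" "V' O V' \<subseteq> V"
      using compatible_uniformity_half[OF U(1) V(1)] .
    have "V' `` {z} \<subseteq> U `` {x}" if "(y, z) \<in> V'" for z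
      using that V' V by blast
    then have "V' `` {y} \<subseteq> ?W"
      using V' compatible_uniformity_subset(1)[OF U(1) V'(1)] by blast
    then show ?thesis
      using V' by blast
  qed
  then show "openin Y ?W"
    using U unfolding compatible_uniformity_def by (metis (no_types, lifting) mem_Collect_eq subsetI)
  show "x \<in> ?W"
    using x U by blast
  show "?W \<subseteq> U `` {x}"
    using compatible_uniformity_subset(2)[OF U(1)] by blast
qed

lemma uniformity_on_INT:
  assumes \<U>: "uniformity_on A \<U>" and "finite D" "\<And>i. i \<in> D \<Longrightarrow> V i \<in> \<U>"
  shows "(A \<times> A) \<inter> (\<Inter>i\<in>D. V i) \<in> \<U>"
proof -
  have top: "A \<times> A \<in> \<U>"
    using \<U> unfolding uniformity_on_def by (elim conjE)
  have inter: "\<forall>U\<in>\<U>. \<forall>V\<in>\<U>. U \<inter> V \<in> \<U>"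
    using \<U> unfolding uniformity_on_def by (elim conjE)
  show ?thesis
    using assms(2,3)
  proof (induction D rule: finite_induct)
    case empty
    show ?case
      using top by simp
  next
    case (insert j D)
    have "V j \<in> \<U>" "(A \<times> A) \<inter> (\<Inter>i\<in>D. V i) \<in> \<U>"
      using insert.IH insert.prems by simp_all
    then have "V j \<inter> ((A \<times> A) \<inter> (\<Inter>i\<in>D. V i)) \<in> \<U>"
      by (rule inter[rule_format])
    moreover have "V j \<inter> ((A \<times> A) \<inter> (\<Inter>i\<in>D. V i)) = (A \<times> A) \<inter> (\<Inter>i\<in>insert j D. V i)"
      by blast
    ultimately show ?case
      by (simp only:)
  qed
qed

definition diagonal_nhds :: "'a topology \<Rightarrow> ('a \<times> 'a) set set" where
  "diagonal_nhds Y = {U. U \<subseteq> topspace Y \<times> topspace Y \<and>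
     (\<exists>N. openin (prod_topology Y Y) N \<and> Id_on (topspace Y) \<subseteq> N \<and> N \<subseteq> U)}"

lemma diagonal_nhds_box:
  assumes "U \<in> diagonal_nhds Y" "x \<in> topspace Y"
  obtains W where "openin Y W" "x \<in> W" "W \<times> W \<subseteq> U"
proof -
  obtain N where N: "openin (prod_topology Y Y) N" "Id_on (topspace Y) \<subseteq> N" "N \<subseteq> U"
    using assms unfolding diagonal_nhds_def by blast
  have "(x, x) \<in> N"
    using N assms by auto
  then obtain A B where "openin Y A" "openin Y B" "x \<in> A" "x \<in> B" "A \<times> B \<subseteq> N"
    using N(1) unfolding openin_prod_topology_alt by meson
  then have "openin Y (A \<inter> B)" "x \<in> A \<inter> B" "(A \<inter> B) \<times> (A \<inter> B) \<subseteq> U"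
    using N by auto
  then show ?thesis
    using that by blast
qed

lemma diagonal_nhdsI:
  assumes "U \<subseteq> topspace Y \<times> topspace Y"
    and "\<And>x. x \<in> topspace Y \<Longrightarrow> \<exists>W. openin Y W \<and> x \<in> W \<and> W \<times> W \<subseteq> U"
  shows "U \<in> diagonal_nhds Y"
proof -
  obtain W where W: "\<And>x. x \<in> topspace Y \<Longrightarrow> openin Y (W x) \<and> x \<in> W x \<and> W x \<times> W x \<subseteq> U"
    using assms(2) by metis
  let ?N = "\<Union>x\<in>topspace Y. W x \<times> W x"
  have "openin (prod_topology Y Y) ?N"
    using W by (intro openin_Union) (auto simp: openin_prod_Times_iff)
  moreover have "Id_on (topspace Y) \<subseteq> ?N" "?N \<subseteq> U"
    using W by auto
  ultimately show ?thesis
    using assms(1) unfolding diagonal_nhds_def by blast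
qed

lemma compact_space_finite_subcover:
  assumes "compact_space Y" "\<And>x. x \<in> topspace Y \<Longrightarrow> openin Y (W x) \<and> x \<in> W x"
  obtains D where "finite D" "D \<subseteq> topspace Y" "topspace Y \<subseteq> (\<Union>x\<in>D. W x)"
proof -
  have "\<exists>\<F>. finite \<F> \<and> \<F> \<subseteq> W ` topspace Y \<and> topspace Y \<subseteq> \<Union>\<F>"
    using assms by (intro compactinD[of Y "topspace Y"]) (auto simp: compact_space_def)
  then show ?thesis
    using that by (metis finite_subset_image)
qed

lemma compatible_uniformity_diagonal_nhds:
  assumes comp: "compact_space Y" and haus: "Hausdorff_space Y"
  shows "compatible_uniformity Y (diagonal_nhds Y)"
proof -
  have half: "\<exists>V\<in>diagonal_nhds Y. V O V \<subseteq> U" if U: "U \<in> diagonal_nhds Y" for U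
  proof -
    have reg: "neighbourhood_base_of (closedin Y) Y"
      using comp haus compact_Hausdorff_imp_regular_space neighbourhood_base_of_closedin by blast
    have "\<exists>P W C. openin Y P \<and> P \<times> P \<subseteq> U \<and> openin Y W \<and> closedin Y C \<and> x \<in> W \<and> W \<subseteq> C \<and> C \<subseteq> P"
      if x: "x \<in> topspace Y" for x
    proof -
      obtain P where P: "openin Y P" "x \<in> P" "P \<times> P \<subseteq> U"
        using diagonal_nhds_box[OF U x] .
      then obtain W C where "openin Y W" "closedin Y C" "x \<in> W" "W \<subseteq> C" "C \<subseteq> P"
        using reg unfolding neighbourhood_base_of by meson
      then show ?thesis
        using P by blast
    qed
    then obtain P W C where PWC: "\<And>x. x \<in> topspace Y \<Longrightarrow> openin Y (P x) \<and> P x \<times> P x \<subseteq> U \<and>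
        openin Y (W x) \<and> closedin Y (C x) \<and> x \<in> W x \<and> W x \<subseteq> C x \<and> C x \<subseteq> P x"
      by metis
    obtain D where D: "finite D" "D \<subseteq> topspace Y" "topspace Y \<subseteq> (\<Union>x\<in>D. W x)"
      using compact_space_finite_subcover[OF comp, of W] PWC by blast
    let ?Q = "\<lambda>i. topspace Y - C i"
    let ?V = "(topspace Y \<times> topspace Y) \<inter> (\<Inter>i\<in>D. P i \<times> P i \<union> ?Q i \<times> ?Q i)"
    have "?V \<in> diagonal_nhds Y"
    proof (rule diagonal_nhdsI)
      fix x assume x: "x \<in> topspace Y"
      let ?B = "topspace Y \<inter> (\<Inter>i\<in>D. if x \<in> P i then P i else ?Q i)"
      have "openin Y ?B"
      proof (cases "D = {}")
        case False
        have "openin Y (\<Inter>i\<in>D. if x \<in> P i then P i else ?Q i)"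
          using False D PWC by (intro openin_INT2) auto
        then show ?thesis
          by blast
      qed auto
      moreover have "x \<in> ?B"
      proof -
        have "x \<in> (if x \<in> P i then P i else ?Q i)" if "i \<in> D" for i
        proof -
          have "C i \<subseteq> P i"
            using D(2) PWC that by blast
          then show ?thesis
            using x by auto
        qed
        then show ?thesis
          using x by blast
      qed
      moreover have "?B \<times> ?B \<subseteq> ?V"
      proof (rule subrelI)
        fix a b
        assume "(a, b) \<in> ?B \<times> ?B"
        then have a: "a \<in> topspace Y" "a \<in> (\<Inter>i\<in>D. if x \<in> P i then P i else ?Q i)"
          and b: "b \<in> topspace Y" "b \<in> (\<Inter>i\<in>D. if x \<in> P i then P i else ?Q i)"
          by (simp_all only: mem_Times_iff Int_iff fst_conv snd_conv)
        have "(a, b) \<in> P i \<times> P i \<union> ?Q i \<times> ?Q i" if "i \<in> D" for i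
          using INT_D[OF a(2) that] INT_D[OF b(2) that] by (cases "x \<in> P i") simp_all
        then show "(a, b) \<in> ?V"
          using a(1) b(1) by blast
      qed
      ultimately show "\<exists>B. openin Y B \<and> x \<in> B \<and> B \<times> B \<subseteq> ?V"
        by (intro exI[of _ ?B] conjI)
    qed (rule Int_lower1)
    moreover have "?V O ?V \<subseteq> U"
    proof (rule subrelI)
      fix x z assume "(x, z) \<in> ?V O ?V"
      then obtain y where xy: "(x, y) \<in> ?V" and yz: "(y, z) \<in> ?V"
        by (elim relcompEpair)
      then have "y \<in> topspace Y"
        by simp
      then obtain i where i: "i \<in> D" "y \<in> W i"
        using D(3) by blast
      then have "i \<in> topspace Y"
        using D(2) by blast
      note PWC[OF this]
      then have "y \<in> C i" "P i \<times> P i \<subseteq> U"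
        using i by blast+
      moreover have "(x, y) \<in> P i \<times> P i \<union> ?Q i \<times> ?Q i" "(y, z) \<in> P i \<times> P i \<union> ?Q i \<times> ?Q i"
        using xy yz i(1) by blast+
      ultimately have "x \<in> P i" "z \<in> P i"
        by blast+
      then show "(x, z) \<in> U"
        using \<open>P i \<times> P i \<subseteq> U\<close> by blast
    qed
    ultimately show ?thesis
      by blast
  qed
  have inter: "U \<inter> V \<in> diagonal_nhds Y" if UV: "U \<in> diagonal_nhds Y" "V \<in> diagonal_nhds Y" for U V
  proof (rule diagonal_nhdsI)
    fix x assume x: "x \<in> topspace Y"
    obtain A where A: "openin Y A" "x \<in> A" "A \<times> A \<subseteq> U"
      using diagonal_nhds_box[OF UV(1) x] .
    obtain B where B: "openin Y B" "x \<in> B" "B \<times> B \<subseteq> V"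
      using diagonal_nhds_box[OF UV(2) x] .
    have "openin Y (A \<inter> B)" "x \<in> A \<inter> B" "(A \<inter> B) \<times> (A \<inter> B) \<subseteq> U \<inter> V"
      using A B by auto
    then show "\<exists>W. openin Y W \<and> x \<in> W \<and> W \<times> W \<subseteq> U \<inter> V"
      by blast
  qed (use UV in \<open>auto simp: diagonal_nhds_def\<close>)
  have conv: "U\<inverse> \<in> diagonal_nhds Y" if U: "U \<in> diagonal_nhds Y" for U
  proof (rule diagonal_nhdsI)
    fix x assume x: "x \<in> topspace Y"
    obtain A where "openin Y A" "x \<in> A" "A \<times> A \<subseteq> U"
      using diagonal_nhds_box[OF U x] .
    then show "\<exists>W. openin Y W \<and> x \<in> W \<and> W \<times> W \<subseteq> U\<inverse>"
      by blast
  qed (use U in \<open>auto simp: diagonal_nhds_def\<close>)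
  have top: "topspace Y \<times> topspace Y \<in> diagonal_nhds Y"
    by (rule diagonal_nhdsI) auto
  have sub: "Id_on (topspace Y) \<subseteq> U \<and> U \<subseteq> topspace Y \<times> topspace Y" if "U \<in> diagonal_nhds Y" for U
    using that unfolding diagonal_nhds_def mem_Collect_eq by (metis order_trans)
  have up: "V \<in> diagonal_nhds Y"
    if "U \<in> diagonal_nhds Y" "U \<subseteq> V" "V \<subseteq> topspace Y \<times> topspace Y" for U V
    using that unfolding diagonal_nhds_def mem_Collect_eq by (metis order_trans)
  have "uniformity_on (topspace Y) (diagonal_nhds Y)"
    unfolding uniformity_on_def
    using top sub up inter conv half by simp
  moreover have "openin Y W \<longleftrightarrow>
    W \<subseteq> topspace Y \<and> (\<forall>x\<in>W. \<exists>U\<in>diagonal_nhds Y. U `` {x} \<subseteq> W)" for W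
  proof (intro iffI conjI ballI)
    assume W: "openin Y W"
    then show "W \<subseteq> topspace Y"
      by (rule openin_subset)
    fix x assume x: "x \<in> W"
    let ?R = "topspace Y - {x}"
    let ?U = "W \<times> W \<union> ?R \<times> ?R"
    have R: "openin Y ?R"
      using x \<open>W \<subseteq> topspace Y\<close> haus
      by (meson Hausdorff_imp_t1_space closedin_t1_singleton openin_diff openin_topspace subsetD)
    have "?U \<in> diagonal_nhds Y"
    proof (rule diagonal_nhdsI)
      show "?U \<subseteq> topspace Y \<times> topspace Y"
        using \<open>W \<subseteq> topspace Y\<close> by blast
      fix y assume "y \<in> topspace Y"
      then show "\<exists>V. openin Y V \<and> y \<in> V \<and> V \<times> V \<subseteq> ?U"
        using R W x by (cases "y = x") blast+
    qed
    moreover have "?U `` {x} \<subseteq> W"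
      by blast
    ultimately show "\<exists>U\<in>diagonal_nhds Y. U `` {x} \<subseteq> W"
      by blast
  next
    assume W: "W \<subseteq> topspace Y \<and> (\<forall>x\<in>W. \<exists>U\<in>diagonal_nhds Y. U `` {x} \<subseteq> W)"
    have "\<exists>V. openin Y V \<and> x \<in> V \<and> V \<subseteq> W" if x: "x \<in> W" for x
    proof -
      obtain U where U: "U \<in> diagonal_nhds Y" "U `` {x} \<subseteq> W"
        using W x by blast
      obtain V where "openin Y V" "x \<in> V" "V \<times> V \<subseteq> U"
        using diagonal_nhds_box[OF U(1)] W x by blast
      then show ?thesis
        using U by blast
    qed
    then show "openin Y W"
      by (subst openin_subopen) blast
  qed
  ultimately show ?thesis
    unfolding compatible_uniformity_def by blast
qed

lemma compatible_uniformity_eq_diagonal_nhds: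
  assumes comp: "compact_space Y" and unif: "compatible_uniformity Y \<U>"
  shows "\<U> = diagonal_nhds Y"
proof (intro equalityI subsetI)
  fix U assume U: "U \<in> \<U>"
  obtain V where V: "V \<in> \<U>" "V\<inverse> = V" "V O V \<subseteq> U"
    using compatible_uniformity_half[OF unif U] .
  show "U \<in> diagonal_nhds Y"
  proof (rule diagonal_nhdsI)
    show "U \<subseteq> topspace Y \<times> topspace Y"
      using compatible_uniformity_subset[OF unif U] by blast
    fix x assume "x \<in> topspace Y"
    then obtain W where W: "openin Y W" "x \<in> W" "W \<subseteq> V `` {x}"
      using compatible_uniformity_nhd[OF unif V(1)] by blast
    moreover have "W \<times> W \<subseteq> U"
    proof (rule subrelI)
      fix y z assume "(y, z) \<in> W \<times> W"
      then have "(y, x) \<in> V" "(x, z) \<in> V"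
        using W V(2) by blast+
      then show "(y, z) \<in> U"
        using V(3) by blast
    qed
    ultimately show "\<exists>W. openin Y W \<and> x \<in> W \<and> W \<times> W \<subseteq> U"
      by blast
  qed
next
  fix N assume N: "N \<in> diagonal_nhds Y"
  have "\<exists>P W V. P \<times> P \<subseteq> N \<and> V \<in> \<U> \<and> openin Y W \<and> x \<in> W \<and> W \<subseteq> V `` {x} \<and> (V O V) `` {x} \<subseteq> P"
    if x: "x \<in> topspace Y" for x
  proof -
    obtain P where P: "openin Y P" "x \<in> P" "P \<times> P \<subseteq> N"
      using diagonal_nhds_box[OF N x] .
    then obtain U where U: "U \<in> \<U>" "U `` {x} \<subseteq> P"
      using unif unfolding compatible_uniformity_def by blast
    obtain V where V: "V \<in> \<U>" "V\<inverse> = V" "V O V \<subseteq> U"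
      using compatible_uniformity_half[OF unif U(1)] .
    obtain W where "openin Y W" "x \<in> W" "W \<subseteq> V `` {x}"
      using compatible_uniformity_nhd[OF unif V(1) x] .
    moreover have "(V O V) `` {x} \<subseteq> P"
      using U(2) V(3) by blast
    ultimately show ?thesis
      using P(3) V(1) by blast
  qed
  then obtain P W V where PWV: "\<And>x. x \<in> topspace Y \<Longrightarrow> P x \<times> P x \<subseteq> N \<and> V x \<in> \<U> \<and>
      openin Y (W x) \<and> x \<in> W x \<and> W x \<subseteq> V x `` {x} \<and> (V x O V x) `` {x} \<subseteq> P x"
    by metis
  obtain D where D: "finite D" "D \<subseteq> topspace Y" "topspace Y \<subseteq> (\<Union>x\<in>D. W x)"
    using compact_space_finite_subcover[OF comp, of W] PWV by blast
  let ?V = "(topspace Y \<times> topspace Y) \<inter> (\<Inter>i\<in>D. V i)"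
  have "?V \<in> \<U>"
    using unif D PWV unfolding compatible_uniformity_def by (intro uniformity_on_INT) auto
  moreover have "?V \<subseteq> N"
  proof (rule subrelI)
    fix y z assume yz: "(y, z) \<in> ?V"
    then obtain i where i: "i \<in> D" "y \<in> W i"
      using D by blast
    then have i': "i \<in> topspace Y"
      using D by blast
    have V: "V i \<in> \<U>" "W i \<subseteq> V i `` {i}" "(V i O V i) `` {i} \<subseteq> P i" "P i \<times> P i \<subseteq> N"
      using PWV[OF i'] by auto
    have "(i, y) \<in> V i"
      using V(2) i by blast
    moreover have "(y, z) \<in> V i"
      using yz i by blast
    moreover have "(y, y) \<in> V i"
      using compatible_uniformity_subset(2)[OF unif V(1)] yz by blast
    ultimately have "y \<in> P i" "z \<in> P i"
      using V(3) by blast+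
    then show "(y, z) \<in> N"
      using V(4) by blast
  qed
  moreover have "N \<subseteq> topspace Y \<times> topspace Y"
    using N unfolding diagonal_nhds_def by blast
  moreover have "\<forall>U\<in>\<U>. \<forall>V. U \<subseteq> V \<and> V \<subseteq> topspace Y \<times> topspace Y \<longrightarrow> V \<in> \<U>"
    using unif unfolding compatible_uniformity_def uniformity_on_def by (elim conjE)
  ultimately show "N \<in> \<U>"
    by blast
qed

lemma compatible_uniformity_ex1:
  assumes "compact_space Y" "Hausdorff_space Y"
  shows "\<exists>!\<U>. compatible_uniformity Y \<U>"
  using compatible_uniformity_diagonal_nhds[OF assms]
    compatible_uniformity_eq_diagonal_nhds[OF assms(1)] by metis

lemma compatible_the_uniformity:
  assumes "compact_space Y" "Hausdorff_space Y"
  shows "compatible_uniformity Y (the_uniformity Y)"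
  unfolding the_uniformity_def using theI'[OF compatible_uniformity_ex1[OF assms]] .


section \<open>Flows\<close>

locale topological_group = Group.group T for T (structure) +
  fixes \<tau> :: "'t topology"
  assumes topspace_group: "topspace \<tau> = carrier T"
    and continuous_mult: "continuous_map (prod_topology \<tau> \<tau>) \<tau> (\<lambda>(s, t). s \<otimes> t)"
    and continuous_inv: "continuous_map \<tau> \<tau> (\<lambda>t. inv t)"

locale topological_flow = topological_group T \<tau> for T (structure) and \<tau> :: "'t topology" +
  fixes X :: "'x topology" and act :: "'t \<Rightarrow> 'x \<Rightarrow> 'x"
  assumes compact: "compact_space X"
    and Hausdorff: "Hausdorff_space X"
    and continuous_act: "continuous_map (prod_topology \<tau> X) X (\<lambda>(t, x). act t x)"
    and act_mult: "\<lbrakk>s \<in> carrier T; t \<in> carrier T; x \<in> topspace X\<rbrakk>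
      \<Longrightarrow> act (s \<otimes> t) x = act s (act t x)"
    and homeomorphic_act: "t \<in> carrier T \<Longrightarrow> homeomorphic_map X X (act t)"

definition no_isolated_points :: "'x topology \<Rightarrow> bool" where
  "no_isolated_points X \<longleftrightarrow> (\<forall>x\<in>topspace X. \<not> openin X {x})"

definition invariant ::
  "('t, 'm) monoid_scheme \<Rightarrow> 'x topology \<Rightarrow> ('t \<Rightarrow> 'x \<Rightarrow> 'x) \<Rightarrow> 'x set \<Rightarrow> bool" where
  "invariant T X act A \<longleftrightarrow> A \<subseteq> topspace X \<and> (\<forall>t\<in>carrier T. act t ` A \<subseteq> A)"

definition minimal_subset ::
  "('t, 'm) monoid_scheme \<Rightarrow> 'x topology \<Rightarrow> ('t \<Rightarrow> 'x \<Rightarrow> 'x) \<Rightarrow> 'x set \<Rightarrow> bool" where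
  "minimal_subset T X act M \<longleftrightarrow>
     M \<noteq> {} \<and> closedin X M \<and> invariant T X act M \<and>
     \<not> (\<exists>N. N \<subset> M \<and> N \<noteq> {} \<and> closedin X N \<and> invariant T X act N)"

definition proximal_pair ::
  "('t, 'm) monoid_scheme \<Rightarrow> 'y topology \<Rightarrow> ('t \<Rightarrow> 'y \<Rightarrow> 'y) \<Rightarrow> 'y \<Rightarrow> 'y \<Rightarrow> bool" where
  "proximal_pair T Y act x y \<longleftrightarrow>
     x \<in> topspace Y \<and> y \<in> topspace Y \<and>
     (\<forall>U\<in>the_uniformity Y. \<exists>t\<in>carrier T. (act t x, act t y) \<in> U)"

definition distal ::
  "('t, 'm) monoid_scheme \<Rightarrow> 'y topology \<Rightarrow> ('t \<Rightarrow> 'y \<Rightarrow> 'y) \<Rightarrow> bool" where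
  "distal T Y act \<longleftrightarrow>
     (\<forall>x\<in>topspace Y. \<forall>y\<in>topspace Y. x \<noteq> y \<longrightarrow> \<not> proximal_pair T Y act x y)"

definition sensitive ::
  "('t, 'm) monoid_scheme \<Rightarrow> 'y topology \<Rightarrow> ('t \<Rightarrow> 'y \<Rightarrow> 'y) \<Rightarrow> bool" where
  "sensitive T Y act \<longleftrightarrow>
     (\<exists>V\<in>the_uniformity Y. \<forall>x\<in>topspace Y. \<forall>U\<in>the_uniformity Y.
        \<exists>y\<in>U `` {x}. \<exists>t\<in>carrier T. (act t x, act t y) \<notin> V)"

text \<open>\<open>X\<^sup>X\<close> is \<open>product_topology (\<lambda>_. X) (topspace X)\<close>, whose points are the functions from
  \<open>topspace X\<close> to itself that are \<open>undefined\<close> elsewhere. This is why translations are restricted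
  to \<open>topspace X\<close> and composed by \<open>compose (topspace X)\<close>.\<close>

definition enveloping_semigroup ::
  "('t, 'm) monoid_scheme \<Rightarrow> 'x topology \<Rightarrow> ('t \<Rightarrow> 'x \<Rightarrow> 'x) \<Rightarrow> ('x \<Rightarrow> 'x) set" where
  "enveloping_semigroup T X act =
     product_topology (\<lambda>_. X) (topspace X) closure_of
       {restrict (act t) (topspace X) | t. t \<in> carrier T}"

definition enveloping_topology ::
  "('t, 'm) monoid_scheme \<Rightarrow> 'x topology \<Rightarrow> ('t \<Rightarrow> 'x \<Rightarrow> 'x) \<Rightarrow> ('x \<Rightarrow> 'x) topology" where
  "enveloping_topology T X act =
     subtopology (product_topology (\<lambda>_. X) (topspace X)) (enveloping_semigroup T X act)"

definition enveloping_act ::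
  "'x topology \<Rightarrow> ('t \<Rightarrow> 'x \<Rightarrow> 'x) \<Rightarrow> 't \<Rightarrow> ('x \<Rightarrow> 'x) \<Rightarrow> ('x \<Rightarrow> 'x)" where
  "enveloping_act X act t p = compose (topspace X) (act t) p"

end

theory Submission
  imports Defs
begin

text \<open>By distality the identity is the only idempotent of \<open>E(X)\<close>: if \<open>u \<circ> u = u\<close>, then \<open>u\<close> maps
  \<open>x\<close> and \<open>u x\<close> to the same point, so they are proximal. Every non-empty closed invariant subset
  of \<open>E(X)\<close> is a semigroup, hence contains an idempotent by the Ellis-Numakura lemma; so
  \<open>(E(X), T)\<close> is minimal. Fix \<open>x0\<close> in \<open>M\<close>; then \<open>p \<mapsto> p x0\<close> is a factor map from \<open>E(X)\<close> onto
  \<open>M\<close>. If \<open>(E(X), T)\<close> is not sensitive, some open \<open>N \<subseteq> E(X)\<close> has a uniformly small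
  orbit after evaluation at \<open>x0\<close>. By minimality and compactness finitely many translates of a closed
  \<open>C \<subseteq> N\<close> cover \<open>E(X)\<close>, so \<open>M\<close> is a finite union of closed sets with uniformly small orbits. The
  union of those which miss a point \<open>z\<close> is closed, so all points near \<open>z\<close> share such a set with \<open>z\<close>
  and \<open>(M, T)\<close> is not sensitive at \<open>z\<close>.\<close>

section \<open>Idempotents in compact semigroups with continuous right multiplications\<close>

text \<open>Zorn's lemma yields a minimal closed subsemigroup \<open>R\<close>. For any
  \<open>u\<close> in \<open>R\<close>, the set \<open>R u\<close> is again a closed subsemigroup,
  so it equals \<open>R\<close> and some \<open>p\<close> has \<open>p u = u\<close>. All such
  \<open>p\<close> in \<open>R\<close> form another one, so it is \<open>R\<close> too and contains
  \<open>u\<close>.\<close>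

lemma ellis_numakura:
  assumes "compact_space P" "Hausdorff_space P"
    and S: "closedin P S" "S \<noteq> {}"
    and mult: "\<And>p q. p \<in> S \<Longrightarrow> q \<in> S \<Longrightarrow> m p q \<in> S"
    and assoc: "\<And>p q r. p \<in> S \<Longrightarrow> q \<in> S \<Longrightarrow> r \<in> S \<Longrightarrow> m (m p q) r = m p (m q r)"
    and cont: "\<And>q. q \<in> S \<Longrightarrow> continuous_map P P (\<lambda>p. m p q)"
  obtains u where "u \<in> S" "m u u = u"
proof -
  define sub where "sub R \<longleftrightarrow> closedin P R \<and> R \<noteq> {} \<and> R \<subseteq> S \<and> (\<forall>p\<in>R. \<forall>q\<in>R. m p q \<in> R)" for R
  have "\<exists>R\<in>Collect sub. \<forall>R'\<in>Collect sub. R \<supseteq> R' \<longrightarrow> R' = R"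
  proof (rule predicate_Zorn)
    show "partial_order_on (Collect sub) (relation_of (\<supseteq>) (Collect sub))"
      by (rule partial_order_on_relation_ofI) auto
    fix C assume "C \<in> Chains (relation_of (\<supseteq>) (Collect sub))"
    then have sub_C: "\<And>R. R \<in> C \<Longrightarrow> sub R"
      and chain: "\<And>R R'. R \<in> C \<Longrightarrow> R' \<in> C \<Longrightarrow> R \<subseteq> R' \<or> R' \<subseteq> R"
      unfolding Chains_def relation_of_def by blast+
    show "\<exists>U\<in>Collect sub. \<forall>R\<in>C. R \<supseteq> U"
    proof (cases "C = {}")
      case True
      have "sub S"
        unfolding sub_def using S mult by simp
      then show ?thesis
        using True by blast
    next
      case False
      have closed: "\<forall>R\<in>C. closedin P R"
        using sub_C unfolding sub_def by simp
      \<comment> \<open>A non-empty finite subchain has its intersection as a member; compactness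
        then gives the whole chain a common point.\<close>
      have "\<Inter>\<F> \<noteq> {}" if \<F>: "finite \<F>" "\<F> \<subseteq> C" for \<F>
      proof (cases "\<F> = {}")
        case False
        have "subset.chain C \<F>"
          unfolding subset_chain_def using \<F>(2) chain by (meson subsetD)
        then have "\<Inter>\<F> \<in> \<F>"
          by (rule Inter_in_chain[OF \<F>(1) False])
        then have "sub (\<Inter>\<F>)"
          using \<F>(2) sub_C by (meson subsetD)
        then show ?thesis
          unfolding sub_def by simp
      qed simp
      then have "\<Inter>C \<noteq> {}"
        using compact_space_fip[THEN iffD1, OF assms(1), rule_format, of C] closed by simp
      moreover have "closedin P (\<Inter>C)"
        using False closed by (intro closedin_Inter) simp_all
      moreover have "\<Inter>C \<subseteq> S"
        using False sub_C unfolding sub_def by (meson Inter_lower equals0I order_trans)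
      moreover have "\<forall>p\<in>\<Inter>C. \<forall>q\<in>\<Inter>C. m p q \<in> \<Inter>C"
        using sub_C unfolding sub_def by simp
      ultimately have "sub (\<Inter>C)"
        unfolding sub_def by simp
      then show ?thesis
        by blast
    qed
  qed
  then obtain R where "sub R" and sub_eq: "\<And>R'. sub R' \<Longrightarrow> R' \<subseteq> R \<Longrightarrow> R' = R"
    by blast
  then have R: "closedin P R" "R \<noteq> {}" "R \<subseteq> S" "\<And>p q. p \<in> R \<Longrightarrow> q \<in> R \<Longrightarrow> m p q \<in> R"
    unfolding sub_def by simp_all
  have min: "R' = R"
    if "closedin P R'" "R' \<noteq> {}" "R' \<subseteq> R" "\<forall>p\<in>R'. \<forall>q\<in>R'. m p q \<in> R'" for R'
    by (rule sub_eq) (use that R(3) in \<open>simp_all add: sub_def\<close>)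
  have R_top: "R \<subseteq> topspace P"
    using R(1) by (rule closedin_subset)
  obtain u where u: "u \<in> R"
    using R(2) by blast
  have cont_u: "continuous_map P P (\<lambda>p. m p u)"
    using cont u R(3) by blast
  have assoc_R: "m (m p q) r = m p (m q r)" if "p \<in> R" "q \<in> R" "r \<in> R" for p q r
    using that R(3) by (intro assoc) auto
  have "(\<lambda>p. m p u) ` R = R"
  proof (rule min)
    show "closedin P ((\<lambda>p. m p u) ` R)"
      using continuous_imp_closed_map[OF cont_u assms(1,2)] R(1)
      unfolding closed_map_def by blast
    show "\<forall>p\<in>(\<lambda>p. m p u) ` R. \<forall>q\<in>(\<lambda>p. m p u) ` R. m p q \<in> (\<lambda>p. m p u) ` R"
    proof clarify
      fix p q assume pq: "p \<in> R" "q \<in> R"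
      \<comment> \<open>Reassociating leaves \<open>u\<close> as the last factor, and the factor
        before it stays in \<open>R\<close>.\<close>
      have "m (m p u) (m q u) = m (m (m p u) q) u"
        using pq u R(4) by (simp add: assoc_R)
      then show "m (m p u) (m q u) \<in> (\<lambda>p. m p u) ` R"
        using pq u R(4) by simp
    qed
    show "(\<lambda>p. m p u) ` R \<subseteq> R"
      using u R(4) by (simp add: image_subset_iff)
  qed (use u in blast)
  then obtain p where p: "p \<in> R" "m p u = u"
    using u by (metis imageE)
  let ?R = "{p \<in> R. m p u = u}"
  have "?R = R"
  proof (rule min)
    have "closedin P {u}"
      using u R_top Hausdorff_imp_t1_space[OF assms(2)] by (simp add: closedin_t1_singleton subset_iff)
    then have "closedin P (R \<inter> {p \<in> topspace P. m p u \<in> {u}})"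
      by (intro closedin_Int R(1) closedin_continuous_map_preimage[OF cont_u])
    also have "R \<inter> {p \<in> topspace P. m p u \<in> {u}} = ?R"
      using R_top by blast
    finally show "closedin P ?R" .
    show "\<forall>p\<in>?R. \<forall>q\<in>?R. m p q \<in> ?R"
      using u R(4) by (simp add: assoc_R)
  qed (use p in blast)+
  then show thesis
    using that[of u] u R(3) by blast
qed

section \<open>Entourages as neighbourhoods of the diagonal\<close>

lemma the_uniformity_eq_diagonal_nhds:
  assumes "compact_space Y" "Hausdorff_space Y"
  shows "the_uniformity Y = diagonal_nhds Y"
  using assms compatible_the_uniformity compatible_uniformity_eq_diagonal_nhds by blast

text \<open>This is uniform continuity: a box around \<open>f x\<close> pulls back to a box around
  \<open>x\<close>. It serves to lift an entourage of the minimal set to the enveloping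
  semigroup.\<close>

lemma diagonal_nhds_vimage:
  assumes f: "continuous_map Y Z f" and U: "U \<in> diagonal_nhds Z"
  shows "{(x, y) \<in> topspace Y \<times> topspace Y. (f x, f y) \<in> U} \<in> diagonal_nhds Y"
proof (rule diagonal_nhdsI)
  fix x assume x: "x \<in> topspace Y"
  then have "f x \<in> topspace Z"
    using f continuous_map_image_subset_topspace by blast
  then obtain W where W: "openin Z W" "f x \<in> W" "W \<times> W \<subseteq> U"
    using diagonal_nhds_box[OF U] by blast
  have "openin Y {y \<in> topspace Y. f y \<in> W}"
    using openin_continuous_map_preimage[OF f W(1)] .
  then show "\<exists>W. openin Y W \<and> x \<in> W \<and>
      W \<times> W \<subseteq> {(x, y) \<in> topspace Y \<times> topspace Y. (f x, f y) \<in> U}"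
    using x W by (intro exI[of _ "{y \<in> topspace Y. f y \<in> W}"]) auto
qed auto

section \<open>The enveloping semigroup as a compact flow\<close>

context topological_flow
begin

abbreviation "self_maps \<equiv> product_topology (\<lambda>_. X) (topspace X)"
abbreviation "translation t \<equiv> restrict (act t) (topspace X)"
abbreviation "E \<equiv> enveloping_semigroup T X act"
abbreviation "E_top \<equiv> enveloping_topology T X act"
abbreviation "E_act \<equiv> enveloping_act X act"

lemma act_continuous: "t \<in> carrier T \<Longrightarrow> continuous_map X X (act t)"
  using homeomorphic_act homeomorphic_imp_continuous_map by blast

lemma act_closed: "t \<in> carrier T \<Longrightarrow> x \<in> topspace X \<Longrightarrow> act t x \<in> topspace X"
  using act_continuous continuous_map_image_subset_topspace by blast

text \<open>Since \<open>act \<one>\<close> is idempotent and injective, one application of it can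
  be cancelled.\<close>

lemma act_one:
  assumes "x \<in> topspace X"
  shows "act \<one> x = x"
proof -
  have "inj_on (act \<one>) (topspace X)"
    using homeomorphic_act[OF one_closed] homeomorphic_imp_injective_map by blast
  moreover have "act \<one> (act \<one> x) = act \<one> x"
    using act_mult[OF one_closed one_closed assms] by simp
  ultimately show ?thesis
    using assms act_closed[OF one_closed assms] by (meson inj_onD)
qed

lemma translation_in_self_maps: "t \<in> carrier T \<Longrightarrow> translation t \<in> topspace self_maps"
  using act_closed by (auto simp: PiE_iff)

lemma compact_self_maps: "compact_space self_maps"
  using compact by (simp add: compact_space_product_topology)

lemma Hausdorff_self_maps: "Hausdorff_space self_maps"
  using Hausdorff by (simp add: Hausdorff_space_product_topology)

lemma closedin_E: "closedin self_maps E"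
  unfolding enveloping_semigroup_def by simp

lemma translation_in_E: "t \<in> carrier T \<Longrightarrow> translation t \<in> E"
  unfolding enveloping_semigroup_def in_closure_of
  using translation_in_self_maps by blast

text \<open>An induction principle for the closure: a closed condition passes from translations to
  all of \<open>E\<close>.\<close>

lemma E_least:
  assumes "closedin self_maps C" "\<And>t. t \<in> carrier T \<Longrightarrow> translation t \<in> C"
  shows "E \<subseteq> C"
  unfolding enveloping_semigroup_def using assms by (intro closure_of_minimal) auto

lemma E_subset: "E \<subseteq> topspace self_maps"
  using closedin_E closedin_subset by blast

lemma topspace_E_top: "topspace E_top = E"
  unfolding enveloping_topology_def using E_subset by auto

lemma compact_E_top: "compact_space E_top"
  unfolding enveloping_topology_def
  using closedin_E compact_self_maps by (blast intro: compact_space_subtopology closedin_compact_space)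

lemma Hausdorff_E_top: "Hausdorff_space E_top"
  unfolding enveloping_topology_def using Hausdorff_self_maps by (rule Hausdorff_space_subtopology)

lemma self_maps_apply: "p \<in> topspace self_maps \<Longrightarrow> x \<in> topspace X \<Longrightarrow> p x \<in> topspace X"
  by auto

lemma continuous_compose_left:
  assumes "continuous_map X X f"
  shows "continuous_map self_maps self_maps (\<lambda>p. compose (topspace X) f p)"
  unfolding continuous_map_componentwise
proof (intro conjI ballI)
  fix x assume x: "x \<in> topspace X"
  have "continuous_map self_maps X (f \<circ> (\<lambda>p. p x))"
    using continuous_map_product_projection[OF x] assms by (rule continuous_map_compose)
  then show "continuous_map self_maps X (\<lambda>p. compose (topspace X) f p x)"
    using x by (simp add: compose_def o_def)
qed (auto simp: compose_def)

text \<open>Coordinate \<open>x\<close> of the composite is coordinate \<open>q x\<close> of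
  \<open>p\<close>, so \<open>q\<close> itself may be discontinuous.\<close>

lemma continuous_compose_right:
  assumes "q \<in> topspace self_maps"
  shows "continuous_map self_maps self_maps (\<lambda>p. compose (topspace X) p q)"
  unfolding continuous_map_componentwise
proof (intro conjI ballI)
  fix x assume x: "x \<in> topspace X"
  show "continuous_map self_maps X (\<lambda>p. compose (topspace X) p q x)"
    using x continuous_map_product_projection[OF self_maps_apply[OF assms x]]
    by (simp add: compose_def)
qed (auto simp: compose_def)

text \<open>Identifies the action with left multiplication by a point of \<open>E\<close>, which
  ties invariant sets to ideals.\<close>

lemma E_act_eq: "E_act t p = compose (topspace X) (translation t) p" if "p \<in> topspace self_maps"
  using that unfolding enveloping_act_def compose_def by (auto simp: fun_eq_iff)

lemma E_act_apply: "x \<in> topspace X \<Longrightarrow> E_act t p x = act t (p x)"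
  unfolding enveloping_act_def by (simp add: compose_def)

lemma E_act_translation:
  assumes "s \<in> carrier T" "t \<in> carrier T"
  shows "E_act s (translation t) = translation (s \<otimes> t)"
  using assms act_mult unfolding enveloping_act_def compose_def by (auto simp: fun_eq_iff)

lemma E_act_mult:
  assumes "s \<in> carrier T" "t \<in> carrier T" "p \<in> topspace self_maps"
  shows "E_act (s \<otimes> t) p = E_act s (E_act t p)"
  using assms act_mult self_maps_apply[OF assms(3)]
  unfolding enveloping_act_def compose_def by (auto simp: fun_eq_iff)

lemma E_act_closed:
  assumes t: "t \<in> carrier T" and p: "p \<in> E"
  shows "E_act t p \<in> E"
proof -
  have "E \<subseteq> {p \<in> topspace self_maps. compose (topspace X) (act t) p \<in> E}"
  proof (rule E_least)
    show "closedin self_maps {p \<in> topspace self_maps. compose (topspace X) (act t) p \<in> E}"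
      using continuous_compose_left[OF act_continuous[OF t]] closedin_E
      by (rule closedin_continuous_map_preimage)
    show "translation s \<in> {p \<in> topspace self_maps. compose (topspace X) (act t) p \<in> E}"
      if "s \<in> carrier T" for s
      using that t translation_in_self_maps translation_in_E E_act_translation
      unfolding enveloping_act_def by simp
  qed
  then show ?thesis
    using p unfolding enveloping_act_def by blast
qed

lemma continuous_E_act:
  assumes t: "t \<in> carrier T"
  shows "continuous_map E_top E_top (E_act t)"
proof -
  have "continuous_map self_maps self_maps (E_act t)"
    using continuous_compose_left[OF act_continuous[OF t]] unfolding enveloping_act_def .
  moreover have "E_act t \<in> E \<rightarrow> E"
    using E_act_closed[OF t] by blast
  ultimately show ?thesis
    unfolding enveloping_topology_def
    by (auto intro: continuous_map_from_subtopology simp: continuous_map_in_subtopology)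
qed

lemma continuous_eval:
  assumes x: "x \<in> topspace X"
  shows "continuous_map E_top X (\<lambda>p. p x)"
  unfolding enveloping_topology_def
  using continuous_map_product_projection[OF x] by (rule continuous_map_from_subtopology)

section \<open>Minimality of the enveloping semigroup of a distal flow\<close>

lemma idempotent_eq_identity:
  assumes distal: "distal T X act" and u: "u \<in> E" "compose (topspace X) u u = u"
  shows "u = translation \<one>"
proof
  fix x
  have uX: "u \<in> topspace self_maps"
    using u(1) E_subset by blast
  show "u x = translation \<one> x"
  proof (cases "x \<in> topspace X")
    case x: True
    have uux: "u (u x) = u x"
      using u(2) x by (metis compose_eq)
    have ux: "u x \<in> topspace X"
      using self_maps_apply[OF uX x] .
    have "proximal_pair T X act x (u x)"
      unfolding proximal_pair_def the_uniformity_eq_diagonal_nhds[OF compact Hausdorff]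
    proof (intro conjI ballI)
      fix U assume "U \<in> diagonal_nhds X"
      then obtain W where W: "openin X W" "u x \<in> W" "W \<times> W \<subseteq> U"
        using ux by (rule diagonal_nhds_box)
      \<comment> \<open>A neighbourhood of \<open>u\<close> fixing only the coordinates
        \<open>x\<close> and \<open>u x\<close>. Both values of \<open>u\<close> there equal
        \<open>u x\<close>, so a translation in it brings the two points together inside
        \<open>W\<close>.\<close>
      let ?N = "{p \<in> topspace self_maps. p x \<in> W} \<inter> {p \<in> topspace self_maps. p (u x) \<in> W}"
      have "openin self_maps ?N"
        using x ux W(1)
        by (intro openin_Int openin_continuous_map_preimage[of self_maps X]
            continuous_map_product_projection)
      moreover have "u \<in> ?N"
        using uX W uux by simp
      ultimately have "\<exists>p. p \<in> {translation t | t. t \<in> carrier T} \<and> p \<in> ?N"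
        using u(1)[unfolded enveloping_semigroup_def in_closure_of, THEN conjunct2, rule_format, of ?N]
        by simp
      then obtain t where "t \<in> carrier T" "translation t \<in> ?N"
        by (elim exE conjE CollectE) simp
      then show "\<exists>t\<in>carrier T. (act t x, act t (u x)) \<in> U"
        using x ux W(3) by (intro bexI[of _ t]) auto
    qed (use x ux in auto)
    then have "u x = x"
      using distal x ux unfolding distal_def by metis
    then show ?thesis
      using x act_one by simp
  next
    case False
    then show ?thesis
      \<comment> \<open>Outside the space both functions are \<open>undefined\<close>.\<close>
      using uX by (auto simp: PiE_iff extensional_def)
  qed
qed

lemma E_minimal:
  assumes distal: "distal T X act"
    and L: "closedin self_maps L" "L \<subseteq> E" "L \<noteq> {}"
    and inv: "\<And>t p. t \<in> carrier T \<Longrightarrow> p \<in> L \<Longrightarrow> E_act t p \<in> L"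
  shows "L = E"
proof -
  have LX: "p \<in> topspace self_maps" if "p \<in> L" for p
    using that L(2) E_subset by blast
  \<comment> \<open>\<open>L\<close> is a left ideal: invariance treats translations
    \<open>p\<close>, and continuity in \<open>p\<close> extends this to the closure. In particular
    \<open>L\<close> is a semigroup.\<close>
  have mult: "compose (topspace X) p q \<in> L" if "p \<in> E" "q \<in> L" for p q
  proof -
    have "E \<subseteq> {p \<in> topspace self_maps. compose (topspace X) p q \<in> L}"
    proof (rule E_least)
      show "closedin self_maps {p \<in> topspace self_maps. compose (topspace X) p q \<in> L}"
        using continuous_compose_right[OF LX[OF that(2)]] L(1)
        by (rule closedin_continuous_map_preimage)
      show "translation t \<in> {p \<in> topspace self_maps. compose (topspace X) p q \<in> L}"
        if t: "t \<in> carrier T" for t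
        using translation_in_self_maps[OF t] inv[OF t \<open>q \<in> L\<close>] E_act_eq[OF LX[OF \<open>q \<in> L\<close>]]
        by simp
    qed
    then show ?thesis
      using that(1) by blast
  qed
  obtain u where u: "u \<in> L" "compose (topspace X) u u = u"
  proof (rule ellis_numakura[of self_maps L "compose (topspace X)"])
    fix p q r assume "p \<in> L" "q \<in> L" "r \<in> L"
    then have "r \<in> topspace X \<rightarrow> topspace X"
      using self_maps_apply[OF LX] by blast
    then show "compose (topspace X) (compose (topspace X) p q) r
        = compose (topspace X) p (compose (topspace X) q r)"
      by (auto simp: compose_def fun_eq_iff)
  qed (use compact_self_maps Hausdorff_self_maps L mult LX continuous_compose_right in blast)+
  have one: "translation \<one> \<in> L"
    using idempotent_eq_identity[OF distal] u L(2) by (metis subsetD)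
  \<comment> \<open>The orbit of the identity consists of all translations, which are dense in
    \<open>E\<close>.\<close>
  have "translation t \<in> L" if "t \<in> carrier T" for t
    using inv[OF that one] E_act_translation[OF that one_closed] that by simp
  then show ?thesis
    using E_least[OF L(1)] L(2) by blast
qed

text \<open>The points whose orbits miss \<open>N\<close> form a closed invariant set. By minimality
  it is empty or all of \<open>E\<close>, and the latter fails at points of \<open>N\<close>. Hence
  the preimages of \<open>N\<close> cover \<open>E\<close>, and compactness selects finitely
  many.\<close>

lemma finite_translates_cover:
  assumes distal: "distal T X act" and N: "openin E_top N" "N \<noteq> {}"
  obtains D where "finite D" "D \<subseteq> carrier T" "\<And>p. p \<in> E \<Longrightarrow> \<exists>t\<in>D. E_act t p \<in> N"
proof -
  let ?pre = "\<lambda>t. {p \<in> topspace E_top. E_act t p \<in> N}"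
  have opn: "openin E_top (?pre t)" if "t \<in> carrier T" for t
    using continuous_E_act[OF that] N(1) by (rule openin_continuous_map_preimage)
  let ?L = "topspace E_top - (\<Union>t\<in>carrier T. ?pre t)"
  have NE: "N \<subseteq> E"
    using N(1) openin_subset topspace_E_top by blast
  have "?L = {}"
  proof (rule ccontr)
    assume ne: "?L \<noteq> {}"
    have "?L = E"
    proof (rule E_minimal[OF distal _ _ ne])
      have "closedin E_top ?L"
        using opn by (intro closedin_diff openin_Union) auto
      then show "closedin self_maps ?L"
        using closedin_E unfolding enveloping_topology_def by (rule closedin_trans_full)
      show "?L \<subseteq> E"
        using topspace_E_top by blast
      fix t p assume t: "t \<in> carrier T" and p: "p \<in> ?L"
      then have pE: "p \<in> E" and out: "\<And>s. s \<in> carrier T \<Longrightarrow> E_act s p \<notin> N"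
        using topspace_E_top by auto
      have "E_act s (E_act t p) \<notin> N" if s: "s \<in> carrier T" for s
        using out[of "s \<otimes> t"] E_act_mult[OF s t] pE E_subset s t by auto
      then show "E_act t p \<in> ?L"
        using E_act_closed[OF t pE] topspace_E_top by auto
    qed
    moreover obtain p where p: "p \<in> N"
      using N(2) by blast
    moreover have "E_act \<one> p = p"
    proof
      fix x
      have "p \<in> topspace self_maps"
        using p NE E_subset by blast
      then show "E_act \<one> p x = p x"
        using act_one self_maps_apply unfolding enveloping_act_def compose_def
        by (cases "x \<in> topspace X") (auto simp: PiE_iff extensional_def)
    qed
    ultimately have "E_act \<one> p \<in> N" "p \<in> ?L"
      using NE by (simp_all only: subset_iff)
    then show False
      by blast
  qed
  then have "topspace E_top \<subseteq> \<Union>(?pre ` carrier T)"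
    by blast
  moreover have "compactin E_top (topspace E_top)"
    using compact_E_top unfolding compact_space_def .
  ultimately obtain \<F> where \<F>: "finite \<F>" "\<F> \<subseteq> ?pre ` carrier T" "topspace E_top \<subseteq> \<Union>\<F>"
    using compactinD[of E_top "topspace E_top" "?pre ` carrier T"] opn by blast
  obtain D where D: "D \<subseteq> carrier T" "finite D" "\<F> = ?pre ` D"
    using finite_subset_image[OF \<F>(1,2)] by blast
  show thesis
  proof (rule that[OF D(2,1)])
    fix p assume "p \<in> E"
    then show "\<exists>t\<in>D. E_act t p \<in> N"
      using \<F>(3) D(3) topspace_E_top by blast
  qed
qed

section \<open>Transfer of sensitivity along evaluation at a point\<close>

text \<open>The image stays in \<open>M\<close> because this is a closed condition valid for
  translations. It is closed by compactness and invariant by equivariance of evaluation, so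
  minimality of \<open>M\<close> forces equality.\<close>

lemma eval_E_eq_minimal:
  assumes M: "minimal_subset T X act M" and x: "x \<in> M"
  shows "(\<lambda>p. p x) ` E = M"
proof -
  have MX: "closedin X M" "M \<subseteq> topspace X" and inv: "\<And>t y. t \<in> carrier T \<Longrightarrow> y \<in> M \<Longrightarrow> act t y \<in> M"
    using M unfolding minimal_subset_def invariant_def by auto
  have xX: "x \<in> topspace X"
    using x MX by blast
  have "E \<subseteq> {p \<in> topspace self_maps. p x \<in> M}"
  proof (rule E_least)
    show "closedin self_maps {p \<in> topspace self_maps. p x \<in> M}"
      using continuous_map_product_projection[OF xX] MX(1)
      by (rule closedin_continuous_map_preimage)
    show "translation t \<in> {p \<in> topspace self_maps. p x \<in> M}" if "t \<in> carrier T" for t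
      using that translation_in_self_maps[OF that] inv x xX by simp
  qed
  then have sub: "(\<lambda>p. p x) ` E \<subseteq> M"
    by blast
  moreover have "closedin X ((\<lambda>p. p x) ` E)"
    using continuous_imp_closed_map[OF continuous_eval[OF xX] compact_E_top Hausdorff]
      topspace_E_top closedin_topspace unfolding closed_map_def by metis
  moreover have "invariant T X act ((\<lambda>p. p x) ` E)"
    unfolding invariant_def
  proof (intro conjI ballI)
    fix t assume t: "t \<in> carrier T"
    have "act t (p x) \<in> (\<lambda>p. p x) ` E" if "p \<in> E" for p
      using E_act_closed[OF t that] E_act_apply[OF xX, of t p] by (metis image_eqI)
    then show "act t ` (\<lambda>p. p x) ` E \<subseteq> (\<lambda>p. p x) ` E"
      by blast
  qed (use sub MX in blast)
  moreover have "(\<lambda>p. p x) ` E \<noteq> {}"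
    using translation_in_E[OF one_closed] by blast
  ultimately show ?thesis
    using M unfolding minimal_subset_def by blast
qed

lemma not_sensitive_if_finite_small_cover:
  assumes Y: "compact_space Y" "Hausdorff_space Y" "topspace Y \<noteq> {}"
    and V: "V \<in> the_uniformity Y"
    and D: "finite D" "topspace Y \<subseteq> (\<Union>i\<in>D. A i)" "\<And>i. i \<in> D \<Longrightarrow> closedin Y (A i)"
    and small: "\<And>i y z t. \<lbrakk>i \<in> D; y \<in> A i; z \<in> A i; t \<in> carrier T\<rbrakk> \<Longrightarrow> (act t y, act t z) \<in> V"
  shows "\<exists>x\<in>topspace Y. \<exists>U\<in>the_uniformity Y. \<forall>y\<in>U `` {x}. \<forall>t\<in>carrier T. (act t x, act t y) \<in> V"
proof -
  obtain z where z: "z \<in> topspace Y"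
    using Y(3) by blast
  \<comment> \<open>Removing the finitely many closed pieces that miss \<open>z\<close> leaves an
    open neighbourhood of \<open>z\<close>; any piece meeting it must contain
    \<open>z\<close>.\<close>
  let ?W = "topspace Y - (\<Union>i\<in>{i \<in> D. z \<notin> A i}. A i)"
  have "openin Y ?W"
    using D by (intro openin_diff closedin_Union) auto
  moreover have "z \<in> ?W"
    using z by blast
  ultimately obtain U where U: "U \<in> the_uniformity Y" "U `` {z} \<subseteq> ?W"
    using compatible_the_uniformity[OF Y(1,2)] unfolding compatible_uniformity_def by blast
  have "(act t z, act t y) \<in> V" if y: "y \<in> U `` {z}" and t: "t \<in> carrier T" for y t
  proof -
    have yW: "y \<in> ?W"
      using y U(2) by blast
    then obtain i where i: "i \<in> D" "y \<in> A i"
      using D(2) by blast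
    then have "z \<in> A i"
      using yW by blast
    then show ?thesis
      using small i t by blast
  qed
  then show ?thesis
    using z U(1) by blast
qed

lemma sensitive_E_if_distal_sensitive_minimal:
  assumes distal: "distal T X act" and M: "minimal_subset T X act M"
    and sens: "sensitive T (subtopology X M) act"
  shows "sensitive T E_top E_act"
proof (rule ccontr)
  assume nsens: "\<not> sensitive T E_top E_act"
  let ?Y = "subtopology X M"
  have MX: "closedin X M" "M \<subseteq> topspace X" and inv: "\<And>t y. t \<in> carrier T \<Longrightarrow> y \<in> M \<Longrightarrow> act t y \<in> M"
    using M unfolding minimal_subset_def invariant_def by auto
  have Y: "compact_space ?Y" "Hausdorff_space ?Y" "topspace ?Y = M"
    using compact_space_subtopology[OF closedin_compact_space[OF compact MX(1)]]
      Hausdorff_space_subtopology[OF Hausdorff] MX(2) by auto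
  obtain V where V: "V \<in> the_uniformity ?Y" and
    V_sens: "\<forall>x\<in>M. \<forall>U\<in>the_uniformity ?Y. \<exists>y\<in>U `` {x}. \<exists>t\<in>carrier T. (act t x, act t y) \<notin> V"
    using sens unfolding sensitive_def Y(3) by blast
  \<comment> \<open>Half of \<open>V\<close>, since two points of a piece will be compared through a
    third, the moved image of \<open>p\<close>.\<close>
  obtain V' where V': "V' \<in> the_uniformity ?Y" "V'\<inverse> = V'" "V' O V' \<subseteq> V"
    using compatible_uniformity_half[OF compatible_the_uniformity[OF Y(1,2)] V] .
  obtain x where x: "x \<in> M"
    using M unfolding minimal_subset_def by blast
  then have xX: "x \<in> topspace X"
    using MX by blast
  note onto = eval_E_eq_minimal[OF M x]
  have cont: "continuous_map E_top ?Y (\<lambda>p. p x)"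
    using continuous_eval[OF xX] onto topspace_E_top
    by (auto simp: continuous_map_in_subtopology)
  let ?V = "{(p, q) \<in> topspace E_top \<times> topspace E_top. (p x, q x) \<in> V'}"
  have "?V \<in> the_uniformity E_top"
    using diagonal_nhds_vimage[OF cont] V'(1)
    unfolding the_uniformity_eq_diagonal_nhds[OF Y(1,2)]
      the_uniformity_eq_diagonal_nhds[OF compact_E_top Hausdorff_E_top] by blast
  \<comment> \<open>Failure of sensitivity for the lifted entourage: evaluated at \<open>x\<close>,
    the whole orbit of each point of \<open>U[p]\<close> stays \<open>V'\<close>-close to that of
    \<open>p\<close>.\<close>
  with nsens obtain p U where p: "p \<in> E" and U: "U \<in> the_uniformity E_top"
    and small_U: "\<forall>q\<in>U `` {p}. \<forall>t\<in>carrier T. (E_act t p, E_act t q) \<in> ?V"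
    unfolding sensitive_def topspace_E_top by meson
  have small: "(E_act t p x, E_act t q x) \<in> V'" if "(p, q) \<in> U" "t \<in> carrier T" for q t
    using small_U that by blast
  have unif: "compatible_uniformity E_top (the_uniformity E_top)"
    using compatible_the_uniformity[OF compact_E_top Hausdorff_E_top] .
  obtain N where N: "openin E_top N" "p \<in> N" "N \<subseteq> U `` {p}"
    using compatible_uniformity_nhd[OF unif U] p topspace_E_top by blast
  have "neighbourhood_base_of (closedin E_top) E_top"
    using compact_E_top Hausdorff_E_top compact_Hausdorff_imp_regular_space
      neighbourhood_base_of_closedin by blast
  \<comment> \<open>The open \<open>N'\<close> is what translates cover \<open>E\<close> with; the
    closed \<open>C\<close> makes the resulting pieces closed.\<close>
  then obtain N' C where C: "openin E_top N'" "closedin E_top C" "p \<in> N'" "N' \<subseteq> C" "C \<subseteq> N"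
    using N unfolding neighbourhood_base_of by meson
  obtain D where D: "finite D" "D \<subseteq> carrier T" "\<And>q. q \<in> E \<Longrightarrow> \<exists>t\<in>D. E_act t q \<in> N'"
    using finite_translates_cover[OF distal C(1)] C(3) by blast
  \<comment> \<open>The pieces covering \<open>M\<close> are the images of these sets under
    evaluation at \<open>x\<close>.\<close>
  let ?B = "\<lambda>t. {q \<in> topspace E_top. E_act t q \<in> C}"
  have "\<exists>x\<in>topspace ?Y. \<exists>U\<in>the_uniformity ?Y. \<forall>y\<in>U `` {x}. \<forall>t\<in>carrier T. (act t x, act t y) \<in> V"
  proof (rule not_sensitive_if_finite_small_cover[OF Y(1,2) _ V D(1)])
    show "topspace ?Y \<noteq> {}"
      using x Y(3) by blast
    show "topspace ?Y \<subseteq> (\<Union>t\<in>D. (\<lambda>q. q x) ` ?B t)"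
    proof
      fix y assume "y \<in> topspace ?Y"
      then obtain q where q: "q \<in> E" "y = q x"
        using onto Y(3) by blast
      then obtain t where "t \<in> D" "E_act t q \<in> N'"
        using D(3) by blast
      then show "y \<in> (\<Union>t\<in>D. (\<lambda>q. q x) ` ?B t)"
        using q C(4) topspace_E_top by blast
    qed
    fix t assume "t \<in> D"
    then have t: "t \<in> carrier T"
      using D(2) by blast
    have "closedin E_top (?B t)"
      using continuous_E_act[OF t] C(2) by (rule closedin_continuous_map_preimage)
    then show "closedin ?Y ((\<lambda>q. q x) ` ?B t)"
      using continuous_imp_closed_map[OF cont compact_E_top Y(2)] unfolding closed_map_def by blast
    fix y z s assume "y \<in> (\<lambda>q. q x) ` ?B t" "z \<in> (\<lambda>q. q x) ` ?B t" and s: "s \<in> carrier T"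
    then obtain q r where q: "q \<in> E" "E_act t q \<in> C" "y = q x" and r: "r \<in> E" "E_act t r \<in> C" "z = r x"
      using topspace_E_top by blast
    \<comment> \<open>Writing \<open>s\<close> as \<open>?s \<otimes> t\<close> first moves
      \<open>q\<close> and \<open>r\<close> into \<open>C\<close>, where smallness applies to
      \<open>?s\<close>.\<close>
    let ?s = "s \<otimes> inv t"
    have s': "?s \<in> carrier T"
      using s t by simp
    have move: "E_act ?s (E_act t q) x = act s (q x)" if "q \<in> E" for q
    proof -
      have "q x \<in> topspace X"
        using that E_subset self_maps_apply xX by blast
      moreover have "?s \<otimes> t = s"
        using s t by (simp add: m_assoc)
      ultimately show ?thesis
        using act_mult[OF s' t, of "q x"] E_act_apply[OF xX] by metis
    qed
    have "(p, E_act t q) \<in> U" "(p, E_act t r) \<in> U"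
      using C(5) N(3) q(2) r(2) by blast+
    \<comment> \<open>Both points are \<open>V'\<close>-close to \<open>E_act ?s p x\<close>, so
      symmetry and composition put their pair in \<open>V\<close>.\<close>
    then have "(E_act ?s p x, act s y) \<in> V'" "(E_act ?s p x, act s z) \<in> V'"
      using small[OF _ s'] move q(1,3) r(1,3) by metis+
    then show "(act s y, act s z) \<in> V"
      using V'(2,3) by blast
  qed
  then show False
    using V_sens Y(3) by blast
qed

end

theorem theorem8:
  fixes T :: "('t, 'm) monoid_scheme" and \<tau> :: "'t topology"
    and X :: "'x topology" and act :: "'t \<Rightarrow> 'x \<Rightarrow> 'x"
  assumes "topological_flow T \<tau> X act"
    and "no_isolated_points X"
    and "distal T X act"
    and "\<exists>M. minimal_subset T X act M \<and> sensitive T (subtopology X M) act"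
  shows "sensitive T (enveloping_topology T X act) (enveloping_act X act)"
  using assms(3,4) topological_flow.sensitive_E_if_distal_sensitive_minimal[OF assms(1)] by blast

end
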